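(* Let $X$ be a set with at least two elements and let $u,w$ be reduced non-empty words on $X$. Then there exist infinitely many pairs $(v,v')$ of cyclically reduced words such that $v$ is a cyclic permutation of $v'$ and $u*v=v'*u=\hat\rho(w)$.
   Context: Words are elements of the free monoid $\mathcal{M}(X\cup X^{-1})$; $1$ is the empty word; juxtaposition is concatenation. $\rho(w)$ is the reduced form of $w$ (in the free group $\mathcal{F}(X)$, viewed as the set of reduced words). A reduced word is cyclically reduced if its last letter is not the inverse of its first letter. For every word $w$ there are unique reduced $t$ and cyclically reduced $c$ with $\rho(w)=tct^{-1}$ as concatenation; $\hat\rho(w):=c$. The cyclically reduced product of words is $u*v:=\hat\rho(uv)$. A word $w_2w_1$ is a cyclic permutation of $w_1w_2$. *)

theory Defs
  imports Main
begin

text \<open>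
  The letter \<open>(x, True)\<close> stands for the generator \<open>x\<close> and \<open>(x, False)\<close> for its formal inverse,
  so the free monoid on the disjoint union of \<open>X\<close> and its inverses is
  \<open>lists (X \<times> UNIV)\<close>, with concatenation \<open>@\<close> and empty word \<open>[]\<close>.
\<close>

type_synonym 'a letter = "'a \<times> bool"
type_synonym 'a word = "'a letter list"

definition words_on :: "'a set \<Rightarrow> 'a word set" where
  "words_on X = lists (X \<times> UNIV)"

definition inv_letter :: "'a letter \<Rightarrow> 'a letter" where
  "inv_letter a = (fst a, \<not> snd a)"

definition inv_word :: "'a word \<Rightarrow> 'a word" where
  "inv_word w = rev (map inv_letter w)"

definition reduced :: "'a word \<Rightarrow> bool" where
  "reduced w \<longleftrightarrow> successively (\<lambda>a b. b \<noteq> inv_letter a) w"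

text \<open>The empty word counts as cyclically reduced.\<close>

definition cyclically_reduced :: "'a word \<Rightarrow> bool" where
  "cyclically_reduced w \<longleftrightarrow> reduced w \<and> (w \<noteq> [] \<longrightarrow> last w \<noteq> inv_letter (hd w))"

inductive cancel_step :: "'a word \<Rightarrow> 'a word \<Rightarrow> bool" where
  "cancel_step (p @ [a, inv_letter a] @ q) (p @ q)"

text \<open>
  The two definite descriptions below are justified by \<open>ex1_reduced_form\<close> and
  \<open>ex1_cyclic_core\<close>.
\<close>

definition reduced_form :: "'a word \<Rightarrow> 'a word"  (\<open>\<rho>\<close>) where
  "\<rho> w = (THE r. cancel_step\<^sup>*\<^sup>* w r \<and> reduced r)"

definition cyclic_reduced_form :: "'a word \<Rightarrow> 'a word"  (\<open>\<rho>\<^sub>c\<close>) where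
  "\<rho>\<^sub>c w = (THE c. cyclically_reduced c \<and> (\<exists>t. reduced t \<and> \<rho> w = t @ c @ inv_word t))"

definition cyclic_product :: "'a word \<Rightarrow> 'a word \<Rightarrow> 'a word"  (infixl \<open>\<star>\<close> 70) where
  "u \<star> v = \<rho>\<^sub>c (u @ v)"

definition cyclic_permutation :: "'a word \<Rightarrow> 'a word \<Rightarrow> bool" where
  "cyclic_permutation v v' \<longleftrightarrow> (\<exists>w1 w2. v' = w1 @ w2 \<and> v = w2 @ w1)"

lemma inv_letter_inv_letter [simp]: "inv_letter (inv_letter a) = a"
  by (simp add: inv_letter_def)

lemma inv_letter_neq [simp]: "inv_letter a \<noteq> a"
  by (simp add: inv_letter_def prod_eq_iff)

lemma inv_word_simps [simp]:
  "inv_word [] = []"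
  "inv_word (a # w) = inv_word w @ [inv_letter a]"
  "inv_word (v @ w) = inv_word w @ inv_word v"
  by (simp_all add: inv_word_def)

lemma reduced_simps [simp]:
  "reduced []"
  "reduced [a]"
  "reduced (a # b # w) \<longleftrightarrow> b \<noteq> inv_letter a \<and> reduced (b # w)"
  by (simp_all add: reduced_def)

lemma reduced_append:
  "reduced (v @ w) \<longleftrightarrow>
     reduced v \<and> reduced w \<and> (v \<noteq> [] \<longrightarrow> w \<noteq> [] \<longrightarrow> hd w \<noteq> inv_letter (last v))"
  by (auto simp: reduced_def successively_append_iff)

text \<open>Reduction by a single pass from the right, used to prove confluence of cancellation.\<close>

definition push :: "'a letter \<Rightarrow> 'a word \<Rightarrow> 'a word" where
  "push a w = (case w of [] \<Rightarrow> [a] | b # v \<Rightarrow> if b = inv_letter a then v else a # w)"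

lemma reduced_push: "reduced w \<Longrightarrow> reduced (push a w)"
proof (cases w)
  case (Cons b v)
  then show "reduced w \<Longrightarrow> reduced (push a w)"
    by (cases v) (auto simp: push_def)
qed (simp add: push_def)

lemma push_push_inv: "reduced w \<Longrightarrow> push a (push (inv_letter a) w) = w"
proof (cases w)
  case (Cons b v)
  then show "reduced w \<Longrightarrow> push a (push (inv_letter a) w) = w"
    by (cases v) (auto simp: push_def)
qed (simp add: push_def)

lemma reduced_foldr_push: "reduced (foldr push w [])"
  by (induction w) (simp_all add: reduced_push)

lemma foldr_push_reduced: "reduced w \<Longrightarrow> foldr push w [] = w"
proof (induction w)
  case (Cons a w)
  then have "reduced w" by (cases w) auto
  with Cons show ?case by (cases w) (auto simp: push_def)
qed simp

lemma foldr_push_cancel_step: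
  "cancel_step v w \<Longrightarrow> foldr push v [] = foldr push w []"
proof (induction rule: cancel_step.induct)
  case (1 p a q)
  show ?case by (simp add: push_push_inv reduced_foldr_push)
qed

lemma foldr_push_cancel:
  "cancel_step\<^sup>*\<^sup>* v w \<Longrightarrow> foldr push v [] = foldr push w []"
  by (induction rule: rtranclp_induct) (simp_all add: foldr_push_cancel_step)

lemma cancel_step_Cons: "cancel_step v w \<Longrightarrow> cancel_step (a # v) (a # w)"
  by (metis append_Cons cancel_step.simps)

lemma cancel_Cons: "cancel_step\<^sup>*\<^sup>* v w \<Longrightarrow> cancel_step\<^sup>*\<^sup>* (a # v) (a # w)"
  by (induction rule: rtranclp_induct)
    (auto intro: rtranclp.rtrancl_into_rtrancl cancel_step_Cons)

lemma cancel_push: "cancel_step\<^sup>*\<^sup>* (a # w) (push a w)"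
proof (cases w)
  case (Cons b v)
  have "cancel_step ([] @ [a, inv_letter a] @ v) ([] @ v)"
    by (rule cancel_step.intros)
  with Cons show ?thesis by (auto simp: push_def)
qed (simp add: push_def)

lemma cancel_foldr_push: "cancel_step\<^sup>*\<^sup>* w (foldr push w [])"
proof (induction w)
  case (Cons a w)
  have "cancel_step\<^sup>*\<^sup>* (a # w) (a # foldr push w [])"
    using Cons by (rule cancel_Cons)
  also have "cancel_step\<^sup>*\<^sup>* \<dots> (push a (foldr push w []))"
    by (rule cancel_push)
  finally show ?case by simp
qed simp

lemma ex1_reduced_form: "\<exists>!r. cancel_step\<^sup>*\<^sup>* w r \<and> reduced r"
  by (metis cancel_foldr_push foldr_push_cancel foldr_push_reduced reduced_foldr_push)

lemma reduced_form_eq_foldr: "\<rho> w = foldr push w []"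
  unfolding reduced_form_def using ex1_reduced_form
  by (metis (mono_tags, lifting) cancel_foldr_push reduced_foldr_push the_equality)

lemma reduced_reduced_form: "reduced (\<rho> w)"
  by (simp add: reduced_form_eq_foldr reduced_foldr_push)

lemma ex_cyclic_core:
  "reduced r \<Longrightarrow> \<exists>c t. cyclically_reduced c \<and> reduced t \<and> r = t @ c @ inv_word t"
proof (induction "length r" arbitrary: r rule: less_induct)
  case less
  show ?case
  proof (cases "cyclically_reduced r")
    case True
    then show ?thesis by (intro exI[of _ r] exI[of _ "[]"]) simp
  next
    case False
    then have ne: "r \<noteq> []" and l: "last r = inv_letter (hd r)"
      using less.prems by (auto simp: cyclically_reduced_def)
    then obtain a s where r: "r = a # s" by (cases r) auto
    with l have "s \<noteq> []" by (auto dest: sym)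
    then obtain m where s: "s = m @ [inv_letter a]"
      using l r by (metis append_butlast_last_id last_ConsR list.sel(1))
    have "reduced m"
      using less.prems r s reduced_append[of "[a]" s] by (auto simp: reduced_append)
    then obtain c t where ct: "cyclically_reduced c" "reduced t" "m = t @ c @ inv_word t"
      using less.hyps[of m] r s by auto
    have "reduced (([a] @ t) @ (c @ inv_word t @ [inv_letter a]))"
      using less.prems r s ct by simp
    then have "reduced ([a] @ t)"
      by (blast dest: iffD1[OF reduced_append])
    then show ?thesis
      using r s ct by (intro exI[of _ c] exI[of _ "a # t"]) simp
  qed
qed

lemma cyclic_core_unique_aux:
  assumes "t @ c @ inv_word t = t' @ c' @ inv_word t'"
    and "cyclically_reduced c" "length t \<le> length t'"
  shows "c = c' \<and> t = t'"
proof -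
  obtain s where s: "t' = t @ s"
    using assms(1,3) by (metis append_eq_append_conv_if append_take_drop_id)
  then have c: "c = s @ c' @ inv_word s"
    using assms(1) by simp
  have "s = []"
  proof (cases s)
    case (Cons a s')
    then have "hd c = a" "last c = inv_letter a" "c \<noteq> []" using c by auto
    then show ?thesis using assms(2) by (auto simp: cyclically_reduced_def)
  qed
  with s c show ?thesis by simp
qed

lemma cyclic_core_unique:
  assumes "t @ c @ inv_word t = t' @ c' @ inv_word t'"
    and "cyclically_reduced c" "cyclically_reduced c'"
  shows "c = c' \<and> t = t'"
  using cyclic_core_unique_aux assms by (metis nat_le_linear)

lemma ex1_cyclic_core:
  "\<exists>!c. cyclically_reduced c \<and> (\<exists>t. reduced t \<and> \<rho> w = t @ c @ inv_word t)"
  using ex_cyclic_core[OF reduced_reduced_form[of w]] cyclic_core_unique by metis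

end

(* Let c be the cyclic core of w. If a reduced word t is such that r = t c t^-1 is reduced and the
   first letter of t is neither the first letter of u nor the inverse of its last letter, then
   v = u^-1 r and v' = r u^-1 are cyclically reduced, cyclic permutations of each other, and both
   u v and v' u reduce to r, whose cyclic core is c. With two generators there are four letters, so
   one can avoid any two of them; hence t can be chosen of the form a^(n+1) d b for every n. *)

theory Submission
  imports Defs
begin

lemma words_on_append [simp]: "v @ w \<in> words_on X \<longleftrightarrow> v \<in> words_on X \<and> w \<in> words_on X"
  by (auto simp: words_on_def)

lemma inv_word_in_words_on [simp]: "inv_word w \<in> words_on X \<longleftrightarrow> w \<in> words_on X"
  by (induction w) (auto simp: words_on_def inv_letter_def)

lemma inv_letter_eq_iff [simp]: "inv_letter a = inv_letter b \<longleftrightarrow> a = b"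
  by (metis inv_letter_inv_letter)

lemma inv_word_inv_word [simp]: "inv_word (inv_word w) = w"
  by (induction w) auto

lemma inv_word_eq_Nil_iff [simp]: "inv_word w = [] \<longleftrightarrow> w = []"
  by (cases w) auto

lemma hd_inv_word: "w \<noteq> [] \<Longrightarrow> hd (inv_word w) = inv_letter (last w)"
  by (simp add: inv_word_def hd_rev last_map)

lemma last_inv_word: "w \<noteq> [] \<Longrightarrow> last (inv_word w) = inv_letter (hd w)"
  by (simp add: inv_word_def last_rev hd_map)

lemma reduced_inv_word: "reduced w \<Longrightarrow> reduced (inv_word w)"
proof (induction w)
  case (Cons a w)
  then show ?case
    by (cases w) (auto simp: reduced_append)
qed simp

lemma reduced_form_reduced: "reduced w \<Longrightarrow> \<rho> w = w"
  by (simp add: reduced_form_eq_foldr foldr_push_reduced)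

text \<open>On reduced words \<open>push a\<close> undoes \<open>push (inv_letter a)\<close>, so the
  letters cancel from the middle outwards. \<open>r\<close> must vary in the induction, which is
  applied to \<open>push (inv_letter a) r\<close>.\<close>

lemma foldr_push_inv_word: "reduced r \<Longrightarrow> foldr push u (foldr push (inv_word u) r) = r"
proof (induction u arbitrary: r)
  case (Cons a u)
  then show ?case
    by (simp add: reduced_push push_push_inv)
qed simp

lemma reduced_form_inv_word_left: "reduced r \<Longrightarrow> \<rho> (u @ inv_word u @ r) = r"
  by (simp add: reduced_form_eq_foldr foldr_push_reduced foldr_push_inv_word)

text \<open>Reading \<open>u\<close> as the inverse of \<open>inv_word u\<close>, the tail collapses
  to the empty word before \<open>r\<close> is pushed.\<close>

lemma reduced_form_inv_word_right: "reduced r \<Longrightarrow> \<rho> (r @ inv_word u @ u) = r"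
  using foldr_push_inv_word[of "[]" "inv_word u"]
  by (simp add: reduced_form_eq_foldr foldr_push_reduced)

lemma cyclic_reduced_form_eqI:
  assumes "\<rho> w = t @ c @ inv_word t" "cyclically_reduced c" "reduced t"
  shows "\<rho>\<^sub>c w = c"
  unfolding cyclic_reduced_form_def
  by (rule the1_equality[OF ex1_cyclic_core]) (use assms in blast)

lemma cyclic_reduced_formE:
  assumes "reduced w"
  obtains t where "w = t @ \<rho>\<^sub>c w @ inv_word t" "cyclically_reduced (\<rho>\<^sub>c w)"
  using theI'[OF ex1_cyclic_core[of w]] reduced_form_reduced[OF assms]
  unfolding cyclic_reduced_form_def[symmetric] by auto

text \<open>The last letter of \<open>t\<close> meets its own inverse. This is what keeps the cyclic
  core of a non-empty reduced word from being empty.\<close>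

lemma not_reduced_append_inv_word: "t \<noteq> [] \<Longrightarrow> \<not> reduced (t @ inv_word t)"
  by (simp add: reduced_append hd_inv_word)

lemma cyclically_reduced_append:
  assumes "reduced v" "reduced w" "v \<noteq> []" "w \<noteq> []"
    and "hd w \<noteq> inv_letter (last v)" "last w \<noteq> inv_letter (hd v)"
  shows "cyclically_reduced (v @ w)"
  using assms by (simp add: cyclically_reduced_def reduced_append)

text \<open>Cancellation could only occur where \<open>t\<close> meets \<open>c\<close> or where
  \<open>c\<close> meets \<open>inv_word t\<close>; each junction forbids one value of
  \<open>last t\<close>.\<close>

lemma reduced_conjugate:
  assumes "cyclically_reduced c" "c \<noteq> []" "reduced t" "t \<noteq> []"
    and "last t \<noteq> inv_letter (hd c)" "last t \<noteq> last c"
  shows "reduced (t @ c @ inv_word t)"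
proof -
  have "hd c \<noteq> inv_letter (last t)"
    using assms(5) by (metis inv_letter_inv_letter)
  then show ?thesis
    using assms by (simp add: reduced_append cyclically_reduced_def reduced_inv_word hd_inv_word)
qed

text \<open>Three distinct letters suffice, by pigeonhole.\<close>

lemma ex_letter_avoiding_two:
  assumes "\<exists>x\<in>X. \<exists>y\<in>X. x \<noteq> y"
  obtains a :: "'a letter" where "fst a \<in> X" "a \<noteq> p" "a \<noteq> q"
proof -
  obtain x y where xy: "x \<in> X" "y \<in> X" "x \<noteq> y"
    using assms by blast
  have "\<exists>a \<in> {(x, True), (x, False), (y, True)}. a \<noteq> p \<and> a \<noteq> q"
    using xy(3) by auto
  then show thesis
    using xy that by auto
qed

text \<open>The letter \<open>d\<close> is a buffer: \<open>a\<close> and \<open>b\<close> are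
  chosen independently and may be mutually inverse. Copies of \<open>a\<close> never cancel, as no
  letter is its own inverse.\<close>

lemma reduced_replicate_append:
  assumes "d \<noteq> inv_letter a" "d \<noteq> inv_letter b"
  shows "reduced (replicate (Suc n) a @ [d, b])"
proof (induction n)
  case 0
  show ?case using assms by auto
next
  case (Suc n)
  then show ?case by (simp add: inv_letter_neq[symmetric])
qed

theorem corollaryB6:
  fixes X :: "'a set" and u w :: "'a word"
  assumes "\<exists>x\<in>X. \<exists>y\<in>X. x \<noteq> y"
    and "u \<in> words_on X" and "reduced u" and "u \<noteq> []"
    and "w \<in> words_on X" and "reduced w" and "w \<noteq> []"
  shows "infinite {(v, v'). v \<in> words_on X \<and> v' \<in> words_on X \<and>
           cyclically_reduced v \<and> cyclically_reduced v' \<and>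
           cyclic_permutation v v' \<and>
           u \<star> v = v' \<star> u \<and> v' \<star> u = \<rho>\<^sub>c w}"
    (is "infinite ?S")
proof -
  define c where "c = \<rho>\<^sub>c w"
  obtain s where s: "w = s @ c @ inv_word s" and c: "cyclically_reduced c"
    using cyclic_reduced_formE[OF assms(6)] unfolding c_def by metis
  have "c \<noteq> []"
  proof
    assume "c = []"
    then show False
      using s assms(6,7) not_reduced_append_inv_word[of s] by auto
  qed
  have "c \<in> words_on X"
    using s assms(5) by simp
  \<comment> \<open>\<open>a\<close> will begin \<open>r n\<close> and its inverse will end it, so
    these conditions concern the junctions with \<open>inv_word u\<close>.\<close>
  obtain a where a: "fst a \<in> X" "a \<noteq> hd u" "a \<noteq> inv_letter (last u)"
    using ex_letter_avoiding_two[OF assms(1)] by metis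
  \<comment> \<open>\<open>b\<close> will end \<open>t n\<close>, next to the core
    \<open>c\<close>.\<close>
  obtain b where b: "fst b \<in> X" "b \<noteq> inv_letter (hd c)" "b \<noteq> last c"
    using ex_letter_avoiding_two[OF assms(1)] by metis
  obtain d where d: "fst d \<in> X" "d \<noteq> inv_letter a" "d \<noteq> inv_letter b"
    using ex_letter_avoiding_two[OF assms(1)] by metis
  define t where "t n = replicate (Suc n) a @ [d, b]" for n
  define r where "r n = t n @ c @ inv_word (t n)" for n
  define f where "f n = (inv_word u @ r n, r n @ inv_word u)" for n
  have t: "reduced (t n)" "t n \<noteq> []" "hd (t n) = a" "last (t n) = b" "t n \<in> words_on X" for n
    using reduced_replicate_append[OF d(2,3)] a(1) b(1) d(1)
    by (auto simp: t_def words_on_def mem_Times_iff)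
  have r: "reduced (r n)" "r n \<noteq> []" "hd (r n) = a" "last (r n) = inv_letter a"
      "r n \<in> words_on X" for n
    using t[of n] b(2,3) c \<open>c \<noteq> []\<close> \<open>c \<in> words_on X\<close> reduced_conjugate[of c "t n"]
    by (auto simp: r_def last_inv_word)
  have "f n \<in> ?S" for n
  proof -
    \<comment> \<open>The inner junction of one product is the cyclic junction of the other, so the
      same two conditions on \<open>a\<close> serve both.\<close>
    have "cyclically_reduced (inv_word u @ r n)" "cyclically_reduced (r n @ inv_word u)"
      using r[of n] a(2,3) assms(3,4)
      by (auto intro!: cyclically_reduced_append simp: reduced_inv_word hd_inv_word last_inv_word)
    moreover have "cyclic_permutation (inv_word u @ r n) (r n @ inv_word u)"
      by (auto simp: cyclic_permutation_def)
    moreover have "\<rho> (u @ inv_word u @ r n) = r n" "\<rho> ((r n @ inv_word u) @ u) = r n"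
      using r(1)[of n] by (simp_all add: reduced_form_inv_word_left reduced_form_inv_word_right)
    \<comment> \<open>By definition \<open>r n\<close> is already displayed as a conjugate of
      \<open>c\<close> by the reduced word \<open>t n\<close>, so uniqueness of the core
      applies.\<close>
    then have "u \<star> (inv_word u @ r n) = c" "(r n @ inv_word u) \<star> u = c"
      unfolding cyclic_product_def using c t(1)[of n]
      by (metis cyclic_reduced_form_eqI r_def)+
    ultimately show ?thesis
      using r(5)[of n] assms(2) by (simp add: f_def c_def)
  qed
  then have "range f \<subseteq> ?S"
    by (rule image_subsetI)
  moreover have "inj f"
  proof (rule injI)
    fix m n
    assume "f m = f n"
    \<comment> \<open>Comparing lengths is enough: \<open>r n\<close> has length 2 (n + 3) plus that
      of \<open>c\<close>, which determines \<open>n\<close>.\<close>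
    then have "length (r m) = length (r n)"
      by (simp add: f_def)
    then show "m = n"
      by (simp add: r_def t_def inv_word_def)
  qed
  ultimately show ?thesis
    unfolding infinite_iff_countable_subset by blast
qed

end
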